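(* Let $n\geq 3$ be an integer and let $D_n=\{(i,j):1\leq i<j\leq n\}$. Every linear order on $D_n$ is induced by a collection $P=(p_1,\dots,p_n)$ of $n$ pairwise distinct points in $\mathbb{R}^{n-2}$.
   Context: A linear order is a reflexive, transitive, antisymmetric relation in which any two elements are comparable. A collection $P=(p_1,\dots,p_n)$ of points in $\mathbb{R}^d$ (Euclidean norm) induces the relation on $D_n$ given by: $(i_1,i_2)\leq(j_1,j_2)$ if and only if $\|p_{i_1}-p_{i_2}\|\leq\|p_{j_1}-p_{j_2}\|$. This is a linear order when the pairwise distances are all different. A given linear order on $D_n$ is induced by $P$ if it coincides with this relation. *)

theory Defs
  imports "HOL-Analysis.Analysis"
begin

definition index_pairs :: "nat \<Rightarrow> (nat \<times> nat) set" where
  "index_pairs n = {(i, j). 1 \<le> i \<and> i < j \<and> j \<le> n}"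

text \<open>A collection of \<open>n\<close> points is a function on \<open>nat\<close>;
  only its values at \<open>1, \<dots>, n\<close> matter.\<close>

definition distance_relation ::
  "nat \<Rightarrow> (nat \<Rightarrow> real ^ 'd) \<Rightarrow> ((nat \<times> nat) \<times> (nat \<times> nat)) set" where
  "distance_relation n p =
     {((i\<^sub>1, i\<^sub>2), (j\<^sub>1, j\<^sub>2)).
        (i\<^sub>1, i\<^sub>2) \<in> index_pairs n \<and> (j\<^sub>1, j\<^sub>2) \<in> index_pairs n \<and>
        norm (p i\<^sub>1 - p i\<^sub>2) \<le> norm (p j\<^sub>1 - p j\<^sub>2)}"

definition induced_by ::
  "nat \<Rightarrow> ((nat \<times> nat) \<times> (nat \<times> nat)) set \<Rightarrow> (nat \<Rightarrow> real ^ 'd) \<Rightarrow> bool" where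
  "induced_by n r p \<longleftrightarrow> r = distance_relation n p"

end

theory Submission
  imports Defs
begin

text \<open>
  All pairwise distances of a regular simplex with \<open>n\<close> vertices are equal, so any order of the
  distances can be produced by a deformation: prescribe the squared distances \<open>1 + t * a i j\<close>
  with positive weights \<open>a\<close> listed in the required order. Every \<open>t > 0\<close> gives the right order
  and keeps the points apart; the only question is for which \<open>t\<close> such points exist, and in which
  dimension. With one vertex \<open>s\<close> at the origin, the squared distances determine a Gram matrix
  \<open>A + t * B\<close>, and points exist exactly when it is positive semidefinite. At \<open>t = 0\<close> it is
  positive definite, which costs dimension \<open>n - 1\<close>. One dimension is saved by increasing \<open>t\<close>
  until the matrix becomes singular.

  The matrix does become singular for some finite \<open>t\<close> because the weights grow so fast that they
  are not themselves squared distances: if \<open>(p, q)\<close> is the top pair and \<open>s\<close> a third vertex, then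
  \<open>a p q > 2 * a p s + 2 * a q s\<close>, whereas squared Euclidean distances satisfy the
  opposite inequality. Hence \<open>B\<close> takes a negative value. This is where \<open>n \<ge> 3\<close> is needed.

  The critical \<open>t\<close> comes from the minimum of the quotient of the forms \<open>B\<close> and \<open>A\<close> on the unit
  sphere (\<open>psd_pencil_boundary\<close>), singular semidefinite matrices are realised in one dimension
  less than their size (\<open>singular_psd_gram_vectors\<close>), and the two are combined in
  \<open>simplex_deformation\<close>.
\<close>

section \<open>Gram vectors of positive semidefinite matrices\<close>

definition quad_form :: "'a set \<Rightarrow> ('a \<Rightarrow> 'a \<Rightarrow> real) \<Rightarrow> ('a \<Rightarrow> real) \<Rightarrow> real" where
  "quad_form S G x = (\<Sum>i\<in>S. \<Sum>j\<in>S. G i j * x i * x j)"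

definition psd_on :: "'a set \<Rightarrow> ('a \<Rightarrow> 'a \<Rightarrow> real) \<Rightarrow> bool" where
  "psd_on S G \<longleftrightarrow> (\<forall>i\<in>S. \<forall>j\<in>S. G i j = G j i) \<and> (\<forall>x. 0 \<le> quad_form S G x)"

lemma quad_form_cong:
  assumes "\<And>i. i \<in> S \<Longrightarrow> x i = y i"
  shows "quad_form S G x = quad_form S G y"
  unfolding quad_form_def using assms by (intro sum.cong refl) simp

text \<open>
  Isolating one coordinate turns the form into a quadratic polynomial in that coordinate; both the
  behaviour of isotropic vectors and the Schur complement are read off from this.
\<close>

lemma quad_form_insert:
  assumes "finite S" "k \<notin> S" "\<And>i. i \<in> S \<Longrightarrow> G k i = G i k"
  shows "quad_form (insert k S) G x =
    G k k * (x k)\<^sup>2 + 2 * (\<Sum>i\<in>S. G i k * x i) * x k + quad_form S G x"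
proof -
  have "(\<Sum>j\<in>S. G k j * x k * x j) = (\<Sum>i\<in>S. G i k * x i) * x k"
    unfolding sum_distrib_right using assms(3) by (intro sum.cong refl) simp
  moreover have "(\<Sum>i\<in>S. G i k * x i * x k) = (\<Sum>i\<in>S. G i k * x i) * x k"
    by (simp add: sum_distrib_right)
  ultimately show ?thesis
    using assms(1,2) by (simp add: quad_form_def sum.distrib power2_eq_square)
qed

text \<open>Principal submatrices inherit semidefiniteness: extend a test vector by zero.\<close>

lemma psd_on_subset:
  assumes "psd_on S G" "finite S" "T \<subseteq> S"
  shows "psd_on T G"
proof -
  have "0 \<le> quad_form T G x" for x
  proof -
    let ?y = "\<lambda>i. if i \<in> T then x i else 0"
    have "quad_form S G ?y = (\<Sum>i\<in>S. if i \<in> T then (\<Sum>j\<in>S. if j \<in> T then G i j * x i * x j else 0) else 0)"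
      unfolding quad_form_def by (intro sum.cong refl) (auto intro!: sum.cong)
    also have "\<dots> = quad_form T G x"
      using assms(2,3) unfolding quad_form_def
      by (simp add: sum.inter_restrict[symmetric] Int_absorb1)
    finally show ?thesis
      using assms(1) by (metis psd_on_def)
  qed
  then show ?thesis
    using assms(1,3) unfolding psd_on_def by blast
qed

text \<open>
  A root of a nonnegative quadratic polynomial is a minimum, so the derivative vanishes there.
\<close>

lemma nonneg_quadratic_root_critical:
  fixes a b c v :: real
  assumes "\<And>y. 0 \<le> a * y\<^sup>2 + 2 * b * y + c" and "a * v\<^sup>2 + 2 * b * v + c = 0"
  shows "a * v + b = 0"
proof (rule ccontr)
  define w where "w = a * v + b"
  define m where "m = \<bar>a\<bar> + 1"
  assume "a * v + b \<noteq> 0"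
  then have w: "w\<^sup>2 > 0" by (simp add: w_def)
  have m: "m > 0" "a < 2 * m" by (auto simp: m_def)
  \<comment> \<open>Near \<open>v\<close> the polynomial is \<open>a * h\<^sup>2 + 2 * w * h\<close> in the increment \<open>h\<close>; a step against the sign
    of \<open>w\<close>, short enough for the linear term to dominate, makes it negative.\<close>
  have "0 \<le> a * (v - w / m)\<^sup>2 + 2 * b * (v - w / m) + c" by (rule assms(1))
  also have "\<dots> = (a * v\<^sup>2 + 2 * b * v + c) + (a * (w / m)\<^sup>2 - 2 * (w / m) * w)"
    unfolding w_def[symmetric] power2_diff by (simp add: w_def power2_eq_square algebra_simps add_divide_distrib)
  also have "\<dots> = w\<^sup>2 / m\<^sup>2 * (a - 2 * m)"
    using m(1) assms(2) by (simp add: field_simps power2_eq_square)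
  also have "\<dots> < 0"
    using w m by (intro mult_pos_neg) auto
  finally show False by simp
qed

text \<open>
  An isotropic vector of a semidefinite form minimises it, so all partial derivatives vanish there;
  that is, the vector lies in the kernel of the matrix.
\<close>

lemma psd_isotropic_in_radical:
  assumes "psd_on S G" "finite S" "quad_form S G v = 0" "j \<in> S"
  shows "(\<Sum>i\<in>S. G i j * v i) = 0"
proof -
  let ?T = "S - {j}"
  define b where "b = (\<Sum>i\<in>?T. G i j * v i)"
  have S: "S = insert j ?T" using assms(4) by auto
  have sym: "G j i = G i j" if "i \<in> ?T" for i
    using assms(1,4) that by (auto simp: psd_on_def)
  have q: "quad_form S G (v(j := y)) = G j j * y\<^sup>2 + 2 * b * y + quad_form ?T G v" for y
  proof -
    have "quad_form (insert j ?T) G (v(j := y)) =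
        G j j * y\<^sup>2 + 2 * (\<Sum>i\<in>?T. G i j * (v(j := y)) i) * y + quad_form ?T G (v(j := y))"
      using quad_form_insert[of ?T j G "v(j := y)"] assms(2) sym by simp
    moreover have "(\<Sum>i\<in>?T. G i j * (v(j := y)) i) = b"
      unfolding b_def by (intro sum.cong) auto
    moreover have "quad_form ?T G (v(j := y)) = quad_form ?T G v"
      by (rule quad_form_cong) auto
    ultimately show ?thesis using S by simp
  qed
  have "G j j * v j + b = 0"
  proof (rule nonneg_quadratic_root_critical)
    show "0 \<le> G j j * y\<^sup>2 + 2 * b * y + quad_form ?T G v" for y
      using assms(1) q[of y] by (metis psd_on_def)
    show "G j j * (v j)\<^sup>2 + 2 * b * v j + quad_form ?T G v = 0"
      using q[of "v j"] assms(3) by simp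
  qed
  then show ?thesis
    using assms(2,4) by (simp add: sum.remove[of S j] b_def)
qed

text \<open>
  Cholesky factorisation by induction on the size of the matrix. The step splits off the index \<open>k\<close>:
  the Schur complement \<open>H\<close> of the entry \<open>G k k\<close> is again semidefinite, and a new coordinate for
  \<open>k\<close> accounts for the difference of \<open>G\<close> and \<open>H\<close>. If \<open>G k k = 0\<close>, then column \<open>k\<close>
  vanishes; with division by zero yielding zero, the same formulas cover this case.
\<close>

lemma psd_gram_vectors:
  assumes "finite S" "psd_on S G"
  shows "\<exists>u. \<forall>i\<in>S. \<forall>j\<in>S. G i j = (\<Sum>l\<in>S. u i l * u j l)"
  using assms
proof (induction S arbitrary: G rule: finite_induct)
  case empty
  then show ?case by simp
next
  case (insert k S)
  have sym: "G i j = G j i" if "i \<in> insert k S" "j \<in> insert k S" for i j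
    using insert.prems that by (auto simp: psd_on_def)
  have zero: "G j k = 0" if "G k k = 0" "j \<in> S" for j
  proof -
    let ?e = "\<lambda>i. of_bool (i = k) :: real"
    have "quad_form S G ?e = quad_form S G (\<lambda>_. 0)"
      using insert.hyps by (intro quad_form_cong) auto
    then have "quad_form (insert k S) G ?e = 0"
      using that(1) insert.hyps sym
      by (subst quad_form_insert) (auto simp: quad_form_def intro!: sum.neutral)
    then have "(\<Sum>i\<in>insert k S. G i j * ?e i) = 0"
      using psd_isotropic_in_radical[OF insert.prems, of ?e j] insert.hyps that(2) by blast
    moreover have "(\<Sum>i\<in>S. G i j * ?e i) = 0"
      using insert.hyps by (intro sum.neutral) auto
    ultimately have "G k j = 0"
      using insert.hyps by (subst (asm) sum.insert) auto
    then show ?thesis using sym that(2) by simp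
  qed
  have nonneg: "G k k \<ge> 0"
    using psd_on_subset[OF insert.prems, of "{k}"] insert.hyps
    by (auto simp: psd_on_def quad_form_def dest!: spec[of _ "\<lambda>_. 1"])
  define H where "H i j = G i j - G i k * G j k / G k k" for i j
  have "0 \<le> quad_form S H x" for x
  proof -
    define b where "b = (\<Sum>i\<in>S. G i k * x i)"
    \<comment> \<open>The Schur complement is the form minimised over the coordinate \<open>k\<close>; this is the minimiser.\<close>
    let ?y = "x(k := - b / G k k)"
    have "quad_form S H x =
        quad_form S G x - (\<Sum>i\<in>S. \<Sum>j\<in>S. (G i k * x i) * (G j k * x j)) / G k k"
      by (simp add: quad_form_def H_def sum_subtractf sum_divide_distrib algebra_simps)
    also have "\<dots> = quad_form S G x - b\<^sup>2 / G k k"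
      by (simp add: b_def power2_eq_square sum_product)
    also have "\<dots> = G k k * (?y k)\<^sup>2 + 2 * b * ?y k + quad_form S G x"
      by (simp add: power2_eq_square)
    also have "\<dots> = quad_form (insert k S) G ?y"
    proof -
      have "(\<Sum>i\<in>S. G i k * ?y i) = b"
        unfolding b_def using insert.hyps by (intro sum.cong) auto
      moreover have "quad_form S G ?y = quad_form S G x"
        using insert.hyps by (intro quad_form_cong) auto
      ultimately show ?thesis
        using quad_form_insert[of S k G ?y] insert.hyps sym by simp
    qed
    finally show ?thesis
      using insert.prems by (metis psd_on_def)
  qed
  then have "psd_on S H"
    using sym by (auto simp: psd_on_def H_def)
  then obtain u where u: "\<And>i j. i \<in> S \<Longrightarrow> j \<in> S \<Longrightarrow> H i j = (\<Sum>l\<in>S. u i l * u j l)"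
    using insert.IH by blast
  define w where "w i l = (if l = k then G i k / sqrt (G k k) else if i = k then 0 else u i l)" for i l
  have w: "(\<Sum>l\<in>insert k S. w i l * w j l) = G i k * G j k / G k k + (\<Sum>l\<in>S. w i l * w j l)" for i j
    using insert.hyps nonneg by (simp add: w_def)
  have "G i j = (\<Sum>l\<in>insert k S. w i l * w j l)" if ij: "i \<in> insert k S" "j \<in> insert k S" for i j
  proof (cases "i = k \<or> j = k")
    case True
    then have "(\<Sum>l\<in>S. w i l * w j l) = 0"
      using insert.hyps by (intro sum.neutral) (auto simp: w_def)
    moreover have "G i j = G i k * G j k / G k k"
      using True ij sym[of i j] zero[of i] zero[of j] by (cases "G k k = 0") auto
    ultimately show ?thesis by (simp only: w)
  next
    case False
    then have "(\<Sum>l\<in>S. w i l * w j l) = H i j"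
      using ij u insert.hyps by (auto simp: w_def intro!: sum.cong)
    then show ?thesis by (simp only: w) (simp add: H_def)
  qed
  then show ?case by blast
qed

text \<open>
  A kernel vector expresses row \<open>k\<close> of the matrix as a linear combination of the other rows. Gram
  vectors of the other indices, which need one dimension less, therefore extend to \<open>k\<close> by the
  same linear combination.
\<close>

lemma singular_psd_gram_vectors:
  fixes G :: "'m::finite \<Rightarrow> 'm \<Rightarrow> real"
  assumes "CARD('m) = CARD('d::finite) + 1"
    and psd: "psd_on UNIV G" and iso: "quad_form UNIV G v = 0" and k: "v k \<noteq> 0"
  shows "\<exists>u :: 'm \<Rightarrow> real ^ 'd. \<forall>i j. u i \<bullet> u j = G i j"
proof -
  let ?S = "UNIV - {k}"
  obtain w where w: "\<And>i j. i \<noteq> k \<Longrightarrow> j \<noteq> k \<Longrightarrow> G i j = (\<Sum>l\<in>?S. w i l * w j l)"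
    using psd_gram_vectors[of ?S G] psd_on_subset[OF psd, of ?S] by auto
  have "card ?S = CARD('d)"
    using assms(1) by (simp add: card_Diff_singleton)
  then obtain h where h: "bij_betw h (UNIV :: 'd set) ?S"
    by (metis finite_same_card_bij finite)
  define y where "y i = (\<chi> l. w i (h l))" for i
  have y: "y i \<bullet> y j = G i j" if "i \<noteq> k" "j \<noteq> k" for i j
    using that w sum.reindex_bij_betw[OF h, of "\<lambda>l. w i l * w j l"]
    by (simp add: y_def inner_vec_def)
  define c where "c i = - v i / v k" for i
  define z where "z = (\<Sum>i\<in>?S. c i *\<^sub>R y i)"
  have sym: "G i j = G j i" for i j
    using psd by (simp add: psd_on_def)
  have row: "G k j = (\<Sum>i\<in>?S. c i * G i j)" for j
  proof -
    have "G k j * v k + (\<Sum>i\<in>?S. G i j * v i) = 0"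
      using psd_isotropic_in_radical[OF psd _ iso, of j]
      by (simp add: sum.remove[of UNIV k])
    then have "G k j = - (\<Sum>i\<in>?S. G i j * v i) / v k"
      using k by (simp add: field_simps)
    also have "\<dots> = (\<Sum>i\<in>?S. c i * G i j)"
      by (simp add: c_def sum_negf[symmetric] sum_divide_distrib mult.commute)
    finally show ?thesis .
  qed
  have zy: "z \<bullet> y j = G k j" if "j \<noteq> k" for j
    unfolding z_def row[of j] inner_sum_left using that y by (intro sum.cong) auto
  have "z \<bullet> z = (\<Sum>i\<in>?S. c i * (z \<bullet> y i))"
    by (subst (2) z_def) (simp add: inner_sum_right)
  also have "\<dots> = (\<Sum>i\<in>?S. c i * G i k)"
    using zy sym by (intro sum.cong) auto
  also have "\<dots> = G k k" using row by simp
  finally have zz: "z \<bullet> z = G k k" .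
  have yz: "y i \<bullet> z = G i k" if "i \<noteq> k" for i
    using zy[OF that] sym by (simp add: inner_commute)
  show ?thesis
    by (rule exI[of _ "y(k := z)"]) (simp add: y zy yz zz)
qed

section \<open>Degenerating a positive definite form\<close>

text \<open>
  Moving from a positive definite form in a direction that is negative somewhere, one must leave
  the semidefinite cone. The exit point is explicit: if \<open>m\<close> is the minimum of the quotient of the
  two forms, then \<open>m < 0\<close>, and at \<open>t = - 1 / m\<close> the form is still nonnegative but vanishes at the
  minimiser.
\<close>

lemma psd_pencil_boundary:
  fixes A B :: "'m::finite \<Rightarrow> 'm \<Rightarrow> real"
  assumes symA: "\<And>i j. A i j = A j i" and symB: "\<And>i j. B i j = B j i"
    and pos: "\<And>x k. x k \<noteq> 0 \<Longrightarrow> 0 < quad_form UNIV A x"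
    and neg: "quad_form UNIV B y < 0"
  obtains t v k where "0 < t" "psd_on UNIV (\<lambda>i j. A i j + t * B i j)"
    "quad_form UNIV (\<lambda>i j. A i j + t * B i j) v = 0" "v k \<noteq> 0"
proof -
  \<comment> \<open>Vectors of type \<open>real ^ 'm\<close> provide the compact unit sphere.\<close>
  define a where "a x = quad_form UNIV A (($) x)" for x :: "real ^ 'm"
  define b where "b x = quad_form UNIV B (($) x)" for x :: "real ^ 'm"
  have a_pos: "0 < a x" if "x \<noteq> 0" for x
    using pos that by (auto simp: a_def vec_eq_iff)
  have scale: "quad_form UNIV G (\<lambda>i. c * x i) = c\<^sup>2 * quad_form UNIV G x" for G :: "'m \<Rightarrow> 'm \<Rightarrow> real" and c x
    by (simp add: quad_form_def sum_distrib_left power2_eq_square mult_ac)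
  have split: "quad_form UNIV (\<lambda>i j. A i j + t * B i j) (($) x) = a x + t * b x" for t x
    by (simp add: a_def b_def quad_form_def sum.distrib sum_distrib_left algebra_simps)
  have "sphere (0 :: real ^ 'm) 1 \<noteq> {}" by simp
  moreover have "continuous_on (sphere 0 1) (\<lambda>x. b x / a x)"
  proof (rule continuous_on_divide)
    show "continuous_on (sphere 0 1) b" "continuous_on (sphere 0 1) a"
      unfolding a_def b_def quad_form_def by (intro continuous_intros)+
    show "\<forall>x\<in>sphere 0 1. a x \<noteq> 0" using a_pos by (metis dist_self mem_sphere less_irrefl zero_neq_one)
  qed
  ultimately obtain v where v: "v \<in> sphere 0 1" "\<And>x. x \<in> sphere 0 1 \<Longrightarrow> b v / a v \<le> b x / a x"
    using continuous_attains_inf[OF compact_sphere] by blast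
  have v0: "v \<noteq> 0" using v(1) by auto
  define m where "m = b v / a v"
  have bound: "m * a x \<le> b x" for x
  proof (cases "x = 0")
    case True
    then show ?thesis by (simp add: a_def b_def quad_form_def)
  next
    case False
    define c where "c = inverse (norm x)"
    have "m \<le> b (c *\<^sub>R x) / a (c *\<^sub>R x)"
      unfolding m_def using False by (intro v(2)) (simp add: c_def)
    also have "\<dots> = b x / a x"
      using False scale[of _ c "($) x"] by (simp add: a_def b_def c_def quad_form_def)
    finally show ?thesis using a_pos[OF False] by (simp add: pos_le_divide_eq)
  qed
  have "m < 0"
  proof -
    let ?y = "\<chi> i. y i"
    have b_neg: "b ?y < 0"
      using neg by (simp add: b_def quad_form_def)
    have b0: "b 0 = 0" by (simp add: b_def quad_form_def)
    then have "?y \<noteq> 0" using b_neg by (metis less_irrefl)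
    then have "m * a ?y < 0 * a ?y" "0 < a ?y"
      using bound[of ?y] b_neg a_pos by (auto intro: order_le_less_trans)
    then show ?thesis by (simp add: mult_less_0_iff)
  qed
  define t where "t = - 1 / m"
  have "0 < t" using \<open>m < 0\<close> by (simp add: t_def)
  moreover have "psd_on UNIV (\<lambda>i j. A i j + t * B i j)"
  proof -
    have "0 \<le> quad_form UNIV (\<lambda>i j. A i j + t * B i j) x" for x
    proof -
      have "0 \<le> a (\<chi> i. x i) + t * b (\<chi> i. x i)"
        using bound[of "\<chi> i. x i"] \<open>m < 0\<close> by (simp add: t_def field_simps)
      also have "\<dots> = quad_form UNIV (\<lambda>i j. A i j + t * B i j) x"
        unfolding split[symmetric] by (simp add: quad_form_def)
      finally show ?thesis .
    qed
    then show ?thesis unfolding psd_on_def using symA symB by metis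
  qed
  moreover have "quad_form UNIV (\<lambda>i j. A i j + t * B i j) (($) v) = 0"
    unfolding split using a_pos[OF v0] \<open>m < 0\<close>
    by (auto simp: t_def m_def field_simps)
  moreover obtain k where "v $ k \<noteq> 0" using v0 by (auto simp: vec_eq_iff)
  ultimately show thesis using that by blast
qed

section \<open>Deforming the regular simplex\<close>

text \<open>
  The hypothesis \<open>long\<close> says that \<open>s\<close> violates, on the pair \<open>(p, q)\<close>, the inequality
  \<open>d p q \<le> 2 * d p s + 2 * d q s\<close> of squared distances (parallelogram law), so \<open>a\<close> is not a
  squared Euclidean distance and the deformation cannot continue for all \<open>t\<close>. The points are placed
  where it stops, with \<open>s\<close> at the origin.
\<close>

lemma simplex_deformation:
  fixes a :: "'b \<Rightarrow> 'b \<Rightarrow> real"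
  assumes card: "finite X" "card X = CARD('d::finite) + 2"
    and sym: "\<And>i j. a i j = a j i" and diag: "\<And>i. a i i = 0"
    and pqs: "p \<in> X" "q \<in> X" "s \<in> X" "p \<noteq> q" "p \<noteq> s" "q \<noteq> s"
    and long: "2 * a p s + 2 * a q s < a p q"
  shows "\<exists>t>0. \<exists>f :: 'b \<Rightarrow> real ^ 'd.
    \<forall>i\<in>X. \<forall>j\<in>X. (norm (f i - f j))\<^sup>2 = of_bool (i \<noteq> j) + t * a i j"
proof -
  have "card (X - {s}) = CARD('d option)"
    using card pqs by (simp add: card_Diff_singleton card_UNIV_option)
  then obtain h where h: "bij_betw h (UNIV :: 'd option set) (X - {s})"
    by (metis finite_same_card_bij finite card(1) finite_Diff)
  then have inj: "inj h" and ran: "range h = X - {s}"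
    by (auto simp: bij_betw_def)
  \<comment> \<open>The Gram matrix of points with base point \<open>s\<close> has entries
    \<open>(d i s + d j s - d i j) / 2\<close> for squared distances \<open>d\<close>. This is linear in \<open>d\<close>;
    \<open>A\<close> belongs to the regular simplex and \<open>B\<close> to the weights \<open>a\<close>.\<close>
  define A :: "'d option \<Rightarrow> 'd option \<Rightarrow> real" where "A k l = (1 + of_bool (k = l)) / 2" for k l
  define B where "B k l = (a (h k) s + a (h l) s - a (h k) (h l)) / 2" for k l
  have pos: "0 < quad_form UNIV A x" if "x k \<noteq> 0" for x k
  proof -
    have "quad_form UNIV A x =
        (\<Sum>i\<in>UNIV. \<Sum>j\<in>UNIV. (x i * x j + (if i = j then x i * x j else 0)) / 2)"
      unfolding quad_form_def A_def by (intro sum.cong refl) auto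
    also have "\<dots> = ((\<Sum>i\<in>UNIV. x i)\<^sup>2 + (\<Sum>i\<in>UNIV. \<Sum>j\<in>UNIV. if i = j then x i * x j else 0)) / 2"
      by (simp only: sum_divide_distrib[symmetric] sum.distrib power2_eq_square sum_product)
    also have "\<dots> = ((\<Sum>i\<in>UNIV. x i)\<^sup>2 + (\<Sum>i\<in>UNIV. (x i)\<^sup>2)) / 2"
      by (simp add: power2_eq_square)
    also have "\<dots> > 0"
    proof -
      have "0 < (\<Sum>i\<in>UNIV. (x i)\<^sup>2)"
        using that by (intro sum_pos2[of _ k]) auto
      then show ?thesis by (simp add: add_nonneg_pos)
    qed
    finally show ?thesis .
  qed
  obtain k l where kl: "h k = p" "h l = q"
    using ran pqs by (metis DiffI imageE singletonD)
  then have "k \<noteq> l" using pqs by auto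
  \<comment> \<open>If \<open>B\<close> were a Gram matrix, its value at this vector would be the squared length of
    the sum of the vectors from \<open>s\<close> to \<open>p\<close> and \<open>q\<close>.\<close>
  let ?y = "\<lambda>i. if i \<in> {k, l} then 1 else 0 :: real"
  have "quad_form UNIV B ?y = (\<Sum>i\<in>UNIV. if i \<in> {k, l} then (\<Sum>j\<in>UNIV. if j \<in> {k, l} then B i j else 0) else 0)"
    unfolding quad_form_def by (intro sum.cong refl) (auto intro!: sum.cong)
  also have "\<dots> = (\<Sum>i\<in>{k, l}. \<Sum>j\<in>{k, l}. B i j)"
    by (simp only: sum.inter_restrict[symmetric] finite Int_UNIV_left)
  also have "\<dots> = 2 * a p s + 2 * a q s - a p q"
    using \<open>k \<noteq> l\<close> by (simp add: B_def kl diag sym[of q p] field_simps)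
  also have "\<dots> < 0" using long by simp
  finally have neg: "quad_form UNIV B ?y < 0" .
  have "A i j = A j i" "B i j = B j i" for i j
    by (auto simp: A_def B_def sym)
  then obtain t v c where t: "0 < t" and G: "psd_on UNIV (\<lambda>i j. A i j + t * B i j)"
    "quad_form UNIV (\<lambda>i j. A i j + t * B i j) v = 0" "v c \<noteq> 0"
    by (rule psd_pencil_boundary[OF _ _ pos neg])
  obtain u :: "'d option \<Rightarrow> real ^ 'd" where u: "\<And>i j. u i \<bullet> u j = A i j + t * B i j"
    using singular_psd_gram_vectors[where 'd = 'd, OF _ G] by (auto simp: card_UNIV_option)
  define f where "f i = (if i = s then 0 else u (inv h i))" for i
  have fh: "f (h k) = u k" for k
    using ran inj by (auto simp: f_def)
  have fs: "f s = 0" by (simp add: f_def)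
  have hs: "h k \<noteq> s" for k using ran by auto
  have base: "(norm (u k))\<^sup>2 = 1 + t * a (h k) s" for k
    by (simp add: power2_norm_eq_inner u A_def B_def diag)
  have edge: "(norm (u k - u l))\<^sup>2 = of_bool (k \<noteq> l) + t * a (h k) (h l)" for k l
    by (simp add: power2_norm_eq_inner inner_diff u A_def B_def diag sym[of "h l" "h k"] field_simps)
  have "(norm (f i - f j))\<^sup>2 = of_bool (i \<noteq> j) + t * a i j" if ij: "i \<in> X" "j \<in> X" for i j
  proof -
    have h_cases: "x = s \<or> (\<exists>k. x = h k)" if "x \<in> X" for x
      using that ran by auto
    consider "i = s" "j = s" | k where "i = h k" "j = s" | l where "i = s" "j = h l"
      | k l where "i = h k" "j = h l"
      using h_cases[OF ij(1)] h_cases[OF ij(2)] by blast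
    then show ?thesis
    proof cases
      case 1
      then show ?thesis by (simp add: diag)
    next
      case (2 k)
      then show ?thesis using base[of k] hs[of k] by (simp add: fh fs)
    next
      case (3 l)
      then show ?thesis using base[of l] hs[of l] sym[of s "h l"] by (simp add: fh fs)
    next
      case (4 k l)
      then show ?thesis using edge[of k l] by (simp add: fh inj_eq[OF inj])
    qed
  qed
  then have "\<forall>i\<in>X. \<forall>j\<in>X. (norm (f i - f j))\<^sup>2 = of_bool (i \<noteq> j) + t * a i j"
    by blast
  with t show ?thesis by (intro exI[of _ t] exI[of _ f] conjI)
qed

section \<open>Realising a linear order\<close>

lemma linear_order_rank:
  assumes "finite E" "linear_order_on E r"
  obtains f :: "'a \<Rightarrow> nat" where "\<And>x y. x \<in> E \<Longrightarrow> y \<in> E \<Longrightarrow> (x, y) \<in> r \<longleftrightarrow> f x \<le> f y"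
proof -
  define f where "f x = card {z \<in> E. (z, x) \<in> r}" for x
  have refl: "(x, x) \<in> r" if "x \<in> E" for x
    using assms(2) that by (auto simp: order_on_defs refl_on_def)
  have trans: "(x, z) \<in> r" if "(x, y) \<in> r" "(y, z) \<in> r" for x y z
    using assms(2) that by (meson order_on_defs transD)
  have antisym: "x = y" if "(x, y) \<in> r" "(y, x) \<in> r" for x y
    using assms(2) that by (auto simp: order_on_defs antisym_def)
  have total: "(x, y) \<in> r \<or> (y, x) \<in> r" if "x \<in> E" "y \<in> E" for x y
    using assms(2) that refl by (cases "x = y") (auto simp: order_on_defs total_on_def)
  have mono: "f x \<le> f y" if "(x, y) \<in> r" for x y
    unfolding f_def using assms(1) trans that by (intro card_mono) auto
  have strict: "f y < f x" if "x \<in> E" "(x, y) \<notin> r" "(y, x) \<in> r" for x y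
    unfolding f_def using assms(1) trans that refl by (intro psubset_card_mono) auto
  show thesis
  proof
    show "(x, y) \<in> r \<longleftrightarrow> f x \<le> f y" if "x \<in> E" "y \<in> E" for x y
      using mono strict[of x y] total that by fastforce
  qed
qed

theorem proposition9:
  fixes n :: nat and r :: "((nat \<times> nat) \<times> (nat \<times> nat)) set"
  assumes "n \<ge> 3"
    and "CARD('d::finite) = n - 2"
    and "linear_order_on (index_pairs n) r"
  shows "\<exists>p :: nat \<Rightarrow> real ^ 'd. inj_on p {1..n} \<and> induced_by n r p"
proof -
  let ?E = "index_pairs n"
  have "?E \<subseteq> {1..n} \<times> {1..n}" by (auto simp: index_pairs_def)
  then have finE: "finite ?E" by (rule finite_subset) simp
  obtain \<rho> where \<rho>: "\<And>x y. x \<in> ?E \<Longrightarrow> y \<in> ?E \<Longrightarrow> (x, y) \<in> r \<longleftrightarrow> \<rho> x \<le> (\<rho> y :: nat)"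
    using linear_order_rank[OF finE assms(3)] by metis
  have \<rho>_inj: "x = y" if "x \<in> ?E" "y \<in> ?E" "\<rho> x = \<rho> y" for x y
    using \<rho>[of x y] \<rho>[of y x] that assms(3) unfolding order_on_defs by (metis antisymD order_refl)
  \<comment> \<open>Any base above 4 would do: the weight of the top pair has to exceed twice the sum of two
    other weights.\<close>
  define a :: "nat \<Rightarrow> nat \<Rightarrow> real"
    where "a i j = (if i = j then 0 else 5 ^ \<rho> (min i j, max i j))" for i j
  have "(1, 2) \<in> ?E" using assms(1) by (simp add: index_pairs_def)
  then have "Max (\<rho> ` ?E) \<in> \<rho> ` ?E" using finE by (intro Max_in) auto
  then obtain p q where pq: "(p, q) \<in> ?E" and "\<rho> (p, q) = Max (\<rho> ` ?E)" by fastforce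
  then have top: "\<rho> e \<le> \<rho> (p, q)" if "e \<in> ?E" for e using finE that by simp
  have range_pq: "1 \<le> p" "p < q" "q \<le> n" using pq by (auto simp: index_pairs_def)
  have "card ({1..n} - {p, q}) \<noteq> 0"
    using assms(1) range_pq by (subst card_Diff_subset) auto
  then obtain s where s: "s \<in> {1..n}" "s \<noteq> p" "s \<noteq> q"
    by (metis DiffE card.empty ex_in_conv insertI1 insertI2)
  have short: "5 * a x s \<le> a p q" if "x \<in> {p, q}" for x
  proof -
    let ?e = "(min x s, max x s)"
    have e: "?e \<in> ?E" "?e \<noteq> (p, q)" "x \<noteq> s"
      using that s range_pq by (auto simp: index_pairs_def min_def max_def)
    then have "\<rho> ?e < \<rho> (p, q)"
      using top[of ?e] \<rho>_inj[OF e(1) pq] by fastforce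
    then have "(5::real) ^ Suc (\<rho> ?e) \<le> 5 ^ \<rho> (p, q)"
      by (intro power_increasing) auto
    then show ?thesis using e(3) range_pq by (simp add: a_def)
  qed
  have "0 < a p q" using range_pq by (simp add: a_def)
  then have long: "2 * a p s + 2 * a q s < a p q"
    using short[of p] short[of q] by simp
  obtain t and f :: "nat \<Rightarrow> real ^ 'd" where t: "0 < t"
    and f: "\<And>i j. i \<in> {1..n} \<Longrightarrow> j \<in> {1..n} \<Longrightarrow> (norm (f i - f j))\<^sup>2 = of_bool (i \<noteq> j) + t * a i j"
  proof -
    have "card {1..n} = CARD('d) + 2" using assms(1,2) by simp
    moreover have "a i j = a j i" "a i i = 0" for i j
      by (simp_all add: a_def min.commute max.commute)
    moreover have "p \<in> {1..n}" "q \<in> {1..n}" "p \<noteq> q" using range_pq by auto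
    ultimately have "\<exists>t>0. \<exists>f :: nat \<Rightarrow> real ^ 'd.
        \<forall>i\<in>{1..n}. \<forall>j\<in>{1..n}. (norm (f i - f j))\<^sup>2 = of_bool (i \<noteq> j) + t * a i j"
      using s long by (intro simplex_deformation[of "{1..n}" a p q s]) auto
    then show thesis using that by blast
  qed
  have f_edge: "(norm (f i - f j))\<^sup>2 = 1 + t * 5 ^ \<rho> (i, j)" if "(i, j) \<in> ?E" for i j
    using f[of i j] that by (auto simp: index_pairs_def a_def)
  have inj: "inj_on f {1..n}"
  proof (rule inj_onI, rule ccontr)
    fix i j assume ij: "i \<in> {1..n}" "j \<in> {1..n}" "f i = f j" "i \<noteq> j"
    then have "1 + t * a i j = 0" using f[of i j] by simp
    moreover have "0 < t * a i j" using t ij by (simp add: a_def)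
    ultimately show False by simp
  qed
  have order: "((i, j), (k, l)) \<in> r \<longleftrightarrow> norm (f i - f j) \<le> norm (f k - f l)"
    if "(i, j) \<in> ?E" "(k, l) \<in> ?E" for i j k l
  proof -
    have "norm (f i - f j) \<le> norm (f k - f l) \<longleftrightarrow> (norm (f i - f j))\<^sup>2 \<le> (norm (f k - f l))\<^sup>2"
      by simp
    also have "\<dots> \<longleftrightarrow> \<rho> (i, j) \<le> \<rho> (k, l)"
      using t by (simp only: f_edge that) simp
    finally show ?thesis using \<rho> that by simp
  qed
  have field: "r \<subseteq> ?E \<times> ?E"
    using assms(3) by (simp add: order_on_defs)
  have "r = distance_relation n f"
  proof (rule set_eqI)
    fix x :: "(nat \<times> nat) \<times> (nat \<times> nat)"
    obtain i j k l where x: "x = ((i, j), (k, l))" by (metis surj_pair)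
    have "x \<in> r \<longleftrightarrow> (i, j) \<in> ?E \<and> (k, l) \<in> ?E \<and> norm (f i - f j) \<le> norm (f k - f l)"
      using order[of i j k l] field by (auto simp only: x)
    also have "\<dots> \<longleftrightarrow> x \<in> distance_relation n f"
      by (simp add: x distance_relation_def)
    finally show "x \<in> r \<longleftrightarrow> x \<in> distance_relation n f" .
  qed
  with inj show ?thesis
    unfolding induced_by_def by (intro exI[of _ f] conjI)
qed

end
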